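(* For any $\ell,m\in\mathbb{N}$ with $\ell\neq m$, there is a $2$-coloring of $\mathbb{N}$ such that, for every infinite $B\subset\mathbb{N}$ and all $t_1,t_2\in\mathbb{Z}$, the set $$\{mx+\ell y+t_1:x,y\in B,\ x<y\}\cup\{mx+\ell y+t_2:x,y\in B,\ x>y\},$$ whenever it is contained in $\mathbb{N}$, is not monochromatic.
   Context: $\mathbb{N}=\{1,2,3,\ldots\}$. A $2$-coloring of a set $S$ is a map from $S$ to a set with two elements; a subset of $S$ is monochromatic if the coloring is constant on it. The coloring may depend on $m,\ell$ but not on $B,t_1,t_2$. *)

theory Defs
  imports "HOL-Analysis.Analysis"
begin

(* N = {1, 2, 3, ...}, taken as a set of integers so that the integer translates t need no
   coercions. *)
definition pos_nats :: "int set" where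
  "pos_nats = {1..}"

(* The set of two colors is bool.  A coloring of S is a function on the whole type of which only
   the values on S matter: they are the only ones used for subsets of S. *)
definition monochromatic :: "('a \<Rightarrow> bool) \<Rightarrow> 'a set \<Rightarrow> 'a set \<Rightarrow> bool" where
  "monochromatic c S A \<longleftrightarrow> A \<subseteq> S \<and> c constant_on A"

definition pattern_set :: "int \<Rightarrow> int \<Rightarrow> int set \<Rightarrow> int \<Rightarrow> int \<Rightarrow> int set" where
  "pattern_set m l B t1 t2 =
     {m * x + l * y + t1 | x y. x \<in> B \<and> y \<in> B \<and> x < y} \<union>
     {m * x + l * y + t2 | x y. x \<in> B \<and> y \<in> B \<and> x > y}"

end

theory Submission
  imports Defs
begin

text \<open>
  Exchanging \<open>m\<close> with \<open>l\<close> and \<open>t1\<close> with \<open>t2\<close> leaves the pattern unchanged, so let \<open>m < l\<close>, and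
  put \<open>r = l / m > 1\<close>. Color \<open>n\<close> by the parity of \<open>\<lfloor>log r n\<rfloor>\<close>.

  For \<open>a < b\<close> in \<open>B\<close> the pattern contains \<open>p a = m * a + l * b + t1\<close> and
  \<open>q a = m * b + l * a + t2\<close>. For \<open>b\<close> much larger than \<open>a\<close> their ratio is close to \<open>r\<close>, and for
  large \<open>a\<close> it is below \<open>r\<close>, because \<open>r * q a - p a = (l\<^sup>2 / m - m) * a + (r * t2 - t1)\<close>. Hence
  the integer parts of the logarithms of \<open>p a\<close> and \<open>q a\<close> differ by at most one, and if the
  colors agree they are equal (\<open>floor_log_eq_if_parity_eq\<close>). This can happen for a single \<open>a\<close>,
  when \<open>m * b\<close> lies slightly below a power of \<open>r\<close>, but not for two values \<open>a1 < a2\<close> that are far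
  apart. Indeed, if \<open>b\<close> is large enough, then \<open>q a1 \<le> q a2 \<le> p a1\<close>, so that all four logarithms
  have the same integer part, whereas \<open>p a2 \<ge> r * q a1\<close> as soon as \<open>m * a2 + t1\<close> is at least
  \<open>r * (l * a1 + t2)\<close>.
\<close>

lemma floor_log_mono:
  fixes r x y :: real
  assumes "1 < r" "0 < x" "x \<le> y"
  shows "\<lfloor>log r x\<rfloor> \<le> \<lfloor>log r y\<rfloor>"
  using assms by (intro floor_mono) simp

lemma floor_log_mult_base:
  fixes r x :: real
  assumes "1 < r" "0 < x"
  shows "\<lfloor>log r (r * x)\<rfloor> = \<lfloor>log r x\<rfloor> + 1"
  using assms by (simp add: log_mult)

lemma floor_log_eq_if_parity_eq:
  fixes r x y :: real
  assumes "1 < r" "0 < x" "x \<le> y" "y \<le> r * x"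
    and parity: "even \<lfloor>log r x\<rfloor> \<longleftrightarrow> even \<lfloor>log r y\<rfloor>"
  shows "\<lfloor>log r x\<rfloor> = \<lfloor>log r y\<rfloor>"
proof -
  have "\<lfloor>log r x\<rfloor> \<le> \<lfloor>log r y\<rfloor>"
    using assms by (intro floor_log_mono)
  moreover have "\<lfloor>log r y\<rfloor> \<le> \<lfloor>log r x\<rfloor> + 1"
    using floor_log_mono[of r y "r * x"] floor_log_mult_base[of r x] assms by simp
  ultimately have "\<lfloor>log r y\<rfloor> = \<lfloor>log r x\<rfloor> \<or> \<lfloor>log r y\<rfloor> = \<lfloor>log r x\<rfloor> + 1"
    by linarith
  with parity show ?thesis
    by auto
qed

lemma infinite_pos_nats_unbounded:
  assumes "B \<subseteq> pos_nats" "infinite B"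
  shows "\<exists>x\<in>B. N < x"
proof (rule ccontr)
  assume "\<not> ?thesis"
  with assms(1) have "B \<subseteq> {1..N}"
    by (force simp: pos_nats_def)
  with assms(2) show False
    using finite_subset by blast
qed

lemma pattern_set_swap: "pattern_set m l B t1 t2 = pattern_set l m B t2 t1"
  unfolding pattern_set_def by (force simp: add.commute)

lemma log_parity_not_constant_on_pattern_set:
  fixes l m :: int
  assumes m: "1 \<le> m" and ml: "m < l"
    and B: "B \<subseteq> pos_nats" "infinite B"
    and pos: "pattern_set m l B t1 t2 \<subseteq> pos_nats"
  shows "\<not> (\<lambda>n. even \<lfloor>log (of_int l / of_int m) (of_int n)\<rfloor>) constant_on pattern_set m l B t1 t2"
    (is "\<not> ?c constant_on _")
proof
  assume const: "?c constant_on pattern_set m l B t1 t2"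
  define r where "r = real_of_int l / real_of_int m"
  have r: "1 < r"
    using m ml by (simp add: r_def)
  \<comment> \<open>\<open>a1\<close> is large enough for \<open>p a \<le> r * q a\<close> to hold for all \<open>a \<ge> a1\<close>, \<open>a2\<close> for
     \<open>r * q a1 \<le> p a2\<close>, and \<open>b\<close> for \<open>q a2 \<le> p a1\<close>.\<close>
  obtain a1 where a1: "a1 \<in> B" "\<bar>m * t1 - l * t2\<bar> < a1"
    using infinite_pos_nats_unbounded[OF B] by blast
  obtain a2 where a2: "a2 \<in> B" "max a1 \<bar>l * (l * a1 + t2) - m * t1\<bar> < a2"
    using infinite_pos_nats_unbounded[OF B] by blast
  obtain b where b: "b \<in> B" "max a2 \<bar>(l * a2 + t2) - (m * a1 + t1)\<bar> < b"
    using infinite_pos_nats_unbounded[OF B] by blast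
  define p q where "p a = m * a + l * b + t1" and "q a = m * b + l * a + t2" for a
  have mem: "p a \<in> pattern_set m l B t1 t2" "q a \<in> pattern_set m l B t1 t2"
    if "a \<in> B" "a < b" for a
    using that b(1) unfolding p_def q_def pattern_set_def by blast+

  have q_mono: "q a1 \<le> q a2"
    using a2 m ml by (simp add: q_def)
  have p_mono: "p a1 \<le> p a2"
    using a2 m by (simp add: p_def)
  have q_le_p: "q a2 \<le> p a1"
  proof -
    have "(l * a2 + t2) - (m * a1 + t1) \<le> 1 * b"
      using b(2) by linarith
    also have "\<dots> \<le> (l - m) * b"
      using a1 a2 b(2) ml by (intro mult_right_mono) auto
    finally show ?thesis
      by (simp add: p_def q_def algebra_simps)
  qed
  have ratio: "real_of_int (p a) \<le> r * real_of_int (q a)" if "a1 \<le> a" for a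
  proof -
    have "m * t1 - l * t2 \<le> 1 * a"
      using a1 that by linarith
    also have "\<dots> \<le> ((l - m) * (l + m)) * a"
    proof (rule mult_right_mono)
      have "1 * 1 \<le> (l - m) * (l + m)"
        using m ml by (intro mult_mono) auto
      then show "1 \<le> (l - m) * (l + m)"
        by simp
    qed (use a1 that in linarith)
    finally have "m * p a \<le> l * q a"
      by (simp add: p_def q_def algebra_simps)
    then have "real_of_int m * real_of_int (p a) \<le> real_of_int l * real_of_int (q a)"
      by (metis of_int_le_iff of_int_mult)
    then show ?thesis
      using m by (simp add: r_def field_simps)
  qed
  have gap: "r * real_of_int (q a1) \<le> real_of_int (p a2)"
  proof -
    have "l * (l * a1 + t2) - m * t1 \<le> 1 * a2"
      using a2 by linarith
    also have "\<dots> \<le> (m * m) * a2"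
    proof (rule mult_right_mono)
      have "1 * 1 \<le> m * m"
        using m by (intro mult_mono) auto
      then show "1 \<le> m * m"
        by simp
    qed (use a1 a2 in linarith)
    finally have "l * q a1 \<le> m * p a2"
      by (simp add: p_def q_def algebra_simps)
    then have "real_of_int l * real_of_int (q a1) \<le> real_of_int m * real_of_int (p a2)"
      by (metis of_int_le_iff of_int_mult)
    then show ?thesis
      using m by (simp add: r_def field_simps)
  qed

  define k where "k n = \<lfloor>log r (real_of_int n)\<rfloor>" for n :: int
  have k_mono: "k x \<le> k y" if "0 < x" "x \<le> y" for x y
    unfolding k_def using that r by (intro floor_log_mono) auto
  have q_pos: "0 < q a" if "a \<in> B" "a < b" for a
    using mem(2)[OF that] pos by (auto simp: pos_nats_def)
  have k_eq: "k (q a) = k (p a)" if "a \<in> B" "a < b" "a1 \<le> a" "q a \<le> p a" for a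
  proof -
    have "even (k (q a)) \<longleftrightarrow> even (k (p a))"
      using const mem[OF that(1,2)] unfolding constant_on_def k_def r_def by metis
    then show ?thesis
      unfolding k_def using r q_pos[OF that(1,2)] that(4) ratio[OF that(3)]
      by (intro floor_log_eq_if_parity_eq) auto
  qed
  have k1: "k (q a1) = k (p a1)" and k2: "k (q a2) = k (p a2)"
    using k_eq[of a1] k_eq[of a2] a1 a2 b q_mono p_mono q_le_p by auto
  have "k (q a2) \<le> k (p a1)"
    using q_pos[of a2] a2 b q_le_p by (intro k_mono) auto
  with k1 k2 have "k (p a2) \<le> k (q a1)"
    by simp
  moreover have "k (q a1) + 1 \<le> k (p a2)"
  proof -
    have "0 < q a1"
      using q_pos[of a1] a1 a2 b by auto
    then show ?thesis
      unfolding k_def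
      using floor_log_mult_base[of r "q a1"] floor_log_mono[of r "r * q a1" "p a2"] r gap
      by simp
  qed
  ultimately show False
    by simp
qed

theorem proposition5p2:
  fixes l m :: int
  assumes "l \<in> pos_nats" and "m \<in> pos_nats" and "l \<noteq> m"
  shows "\<exists>c :: int \<Rightarrow> bool. \<forall>B t1 t2.
           B \<subseteq> pos_nats \<and> infinite B \<and> pattern_set m l B t1 t2 \<subseteq> pos_nats \<longrightarrow>
           \<not> monochromatic c pos_nats (pattern_set m l B t1 t2)"
proof (cases "m < l")
  case True
  moreover have "1 \<le> m"
    using assms by (simp add: pos_nats_def)
  ultimately show ?thesis
    using log_parity_not_constant_on_pattern_set[of m l] unfolding monochromatic_def by blast
next
  case False
  then have "l < m" "1 \<le> l"
    using assms by (auto simp: pos_nats_def)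
  then have "\<not> (\<lambda>n. even \<lfloor>log (of_int m / of_int l) (of_int n)\<rfloor>) constant_on pattern_set m l B t1 t2"
    if "B \<subseteq> pos_nats" "infinite B" "pattern_set m l B t1 t2 \<subseteq> pos_nats" for B t1 t2
    using log_parity_not_constant_on_pattern_set[of l m B t2 t1] that
    unfolding pattern_set_swap[of m l] by blast
  then show ?thesis
    unfolding monochromatic_def by blast
qed

end
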